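(* Let $C>0$ and let $x,y$ be a pair of points in a weak $C$-rCAT($0;*$) space $(X,d)$, with $L:=d(x,y)$. For $i=1,2$, let $h_i>0$ and let $\gamma_i:[0,L+h_i]\to X$ be an $h_i$-short segment from $x$ to $y$, parametrized by arclength; assume that $h_1\le h_2$. Then $$d(\gamma_1(t),\gamma_2(t))\le 2C+h_2+\frac{\sqrt{2Lh_1+h_1^2}}{2}+\frac{\sqrt{2Lh_2+h_2^2}}{2},\qquad 0\le t\le L+h_1.$$ In particular, if $h_2\le 1/\max\{1,L\}$, then $$d(\gamma_1(t),\gamma_2(t))\le 2C+1+\sqrt3,\qquad 0\le t\le L+h_1.$$
   Context: A length space is a metric space $(X,d)$ in which $d(x,y)$ is the infimum of the lengths of paths joining $x$ and $y$, for all $x,y$. For $h\ge 0$, an $h$-short segment $[x,y]_h$ from $x$ to $y$ is a path $\gamma:[0,L]\to X$ from $x$ to $y$ with $\mathrm{len}(\gamma)\le d(x,y)+h$. For a point $u=\gamma(t)$ on it, $[x,u]_h$ and $[u,y]_h$ denote the subpaths $\gamma|_{[0,t]}$ and $\gamma|_{[t,L]}$. An $h$-short triangle $T_h(x,y,z)$ consists of $x,y,z\in X$ with a choice of $h$-short segments $[x,y]_h,[y,z]_h,[z,x]_h$. A comparison triangle is a Euclidean triangle $T(\bar x,\bar y,\bar z)$ in the plane with $|\bar x-\bar y|=d(x,y)$, $|\bar y-\bar z|=d(y,z)$, $|\bar z-\bar x|=d(z,x)$. A comparison point for $u\in[y,z]_h$ is any $\bar u\in[\bar y,\bar z]$ with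 $|\bar y-\bar u|\le\mathrm{len}([y,u]_h)$ and $|\bar u-\bar z|\le\mathrm{len}([u,z]_h)$. A length space $X$ is weak $C$-rCAT($0;*$) if there is a function $H:X\times X\times X\to(0,\infty)$ such that for all $x,y,z\in X$, every $h$-short triangle $T_h(x,y,z)$ with $h=H(x,y,z)$, every $u\in[y,z]_h$ and every comparison point $\bar u\in[\bar y,\bar z]$ for $u$, one has $d(x,u)\le|\bar x-\bar u|+C$. *)

theory Defs
  imports "HOL-Analysis.Analysis"
begin

text \<open>
  A curve \<open>(L, \<gamma>)\<close> stands for the map \<open>\<gamma>\<close> restricted to \<open>[0, L]\<close>; values of
  \<open>\<gamma>\<close> outside that interval are irrelevant.
\<close>

type_synonym 'a curve = "real \<times> (real \<Rightarrow> 'a)"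

definition path_from_to :: "'a::metric_space curve \<Rightarrow> 'a \<Rightarrow> 'a \<Rightarrow> bool" where
  "path_from_to p x y \<longleftrightarrow> (case p of (L, \<gamma>) \<Rightarrow>
     0 \<le> L \<and> continuous_on {0..L} \<gamma> \<and> \<gamma> 0 = x \<and> \<gamma> L = y)"

text \<open>
  The length of \<open>\<gamma>\<close> on \<open>[a, b]\<close>, possibly infinite: the supremum of the lengths of the
  polygons inscribed along the finite increasing lists of parameters \<open>ts\<close> in \<open>[a, b]\<close>.
\<close>

definition len :: "real \<Rightarrow> real \<Rightarrow> (real \<Rightarrow> 'a::metric_space) \<Rightarrow> ennreal" where
  "len a b \<gamma> =
     (SUP ts \<in> {ts. sorted ts \<and> set ts \<subseteq> {a..b}}.
        \<Sum>i<length ts - 1. ennreal (dist (\<gamma> (ts ! i)) (\<gamma> (ts ! Suc i))))"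

text \<open>The infimum below is \<open>\<infinity>\<close> if no path joins \<open>x\<close> and \<open>y\<close>.\<close>

definition length_space :: "'a::metric_space itself \<Rightarrow> bool" where
  "length_space _ \<longleftrightarrow>
     (\<forall>x y::'a. ennreal (dist x y) = (INF (L, \<gamma>) \<in> {p. path_from_to p x y}. len 0 L \<gamma>))"

definition short_segment :: "real \<Rightarrow> 'a::metric_space \<Rightarrow> 'a \<Rightarrow> 'a curve \<Rightarrow> bool" where
  "short_segment h x y p \<longleftrightarrow> 0 \<le> h \<and> path_from_to p x y \<and>
     (case p of (L, \<gamma>) \<Rightarrow> len 0 L \<gamma> \<le> ennreal (dist x y + h))"

definition short_triangle ::
  "real \<Rightarrow> 'a::metric_space \<Rightarrow> 'a \<Rightarrow> 'a \<Rightarrow> 'a curve \<Rightarrow> 'a curve \<Rightarrow> 'a curve \<Rightarrow> bool" where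
  "short_triangle h x y z pxy pyz pzx \<longleftrightarrow>
     short_segment h x y pxy \<and> short_segment h y z pyz \<and> short_segment h z x pzx"

definition comparison_triangle ::
  "'a::metric_space \<Rightarrow> 'a \<Rightarrow> 'a \<Rightarrow> real^2 \<Rightarrow> real^2 \<Rightarrow> real^2 \<Rightarrow> bool" where
  "comparison_triangle x y z x' y' z' \<longleftrightarrow>
     dist x' y' = dist x y \<and> dist y' z' = dist y z \<and> dist z' x' = dist z x"

text \<open>
  A point \<open>u\<close> of a segment from \<open>y\<close> to \<open>z\<close> is given by its parameter \<open>t\<close>, since the
  subpaths from \<open>y\<close> to \<open>u\<close> and from \<open>u\<close> to \<open>z\<close> depend on \<open>t\<close> when the path visits \<open>u\<close> repeatedly.
\<close>

definition comparison_point ::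
  "'a::metric_space curve \<Rightarrow> real \<Rightarrow> real^2 \<Rightarrow> real^2 \<Rightarrow> real^2 \<Rightarrow> bool" where
  "comparison_point p t y' z' u' \<longleftrightarrow> (case p of (L, \<gamma>) \<Rightarrow>
     u' \<in> closed_segment y' z' \<and>
     ennreal (dist y' u') \<le> len 0 t \<gamma> \<and> ennreal (dist u' z') \<le> len t L \<gamma>)"

definition weak_rCAT0 :: "real \<Rightarrow> 'a::metric_space itself \<Rightarrow> bool" where
  "weak_rCAT0 C X \<longleftrightarrow> length_space X \<and>
     (\<exists>H :: 'a \<Rightarrow> 'a \<Rightarrow> 'a \<Rightarrow> real. (\<forall>x y z. 0 < H x y z) \<and>
       (\<forall>x y z pxy L \<gamma> pzx x' y' z' t u'.
          short_triangle (H x y z) x y z pxy (L, \<gamma>) pzx \<longrightarrow>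
          comparison_triangle x y z x' y' z' \<longrightarrow>
          t \<in> {0..L} \<longrightarrow>
          comparison_point (L, \<gamma>) t y' z' u' \<longrightarrow>
          dist x (\<gamma> t) \<le> dist x' u' + C))"

definition arclength_parametrized :: "'a::metric_space curve \<Rightarrow> bool" where
  "arclength_parametrized p \<longleftrightarrow> (case p of (L, \<gamma>) \<Rightarrow>
     \<forall>s t. 0 \<le> s \<longrightarrow> s \<le> t \<longrightarrow> t \<le> L \<longrightarrow> len s t \<gamma> = ennreal (t - s))"

end

theory Submission
  imports Defs
begin

text \<open>
  Join \<open>x\<close> and \<open>y\<close> by an almost geodesic path \<open>\<sigma>\<close> and apply the weak rCAT condition to the
  triangles with base \<open>\<sigma>\<close> and apexes \<open>\<gamma>\<^sub>1 t\<close> and \<open>\<gamma>\<^sub>2 t\<close>. In the comparison triangle the sum of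
  the two sides at the apex is at most \<open>L + h\<^sub>i\<close>, so the apex lies in an ellipse with foci at
  the ends of the base, and its distance to the base is at most the semi-minor axis
  \<open>sqrt (2 * L * h\<^sub>i + h\<^sub>i\<^sup>2) / 2\<close>. The nearest points of the base both have a distance in
  \<open>[t - h\<^sub>2, t]\<close> from its first end, so the corresponding points of \<open>\<sigma>\<close> are, up to an arbitrarily
  small error, at distance at most \<open>h\<^sub>2\<close>.
\<close>

section \<open>Lengths of curves and short segments\<close>

lemma polygon_le_len:
  assumes "sorted ts" "set ts \<subseteq> {a..b}"
  shows "ennreal (\<Sum>i<length ts - 1. dist (\<gamma> (ts ! i)) (\<gamma> (ts ! Suc i))) \<le> len a b \<gamma>"
proof -
  have "(\<Sum>i<length ts - 1. ennreal (dist (\<gamma> (ts ! i)) (\<gamma> (ts ! Suc i)))) \<le> len a b \<gamma>"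
    unfolding len_def by (rule SUP_upper) (use assms in simp)
  then show ?thesis by simp
qed

lemma dist_le_len:
  assumes "a \<le> b"
  shows "ennreal (dist (\<gamma> a) (\<gamma> b)) \<le> len a b \<gamma>"
  using polygon_le_len[of "[a, b]" a b \<gamma>] assms by simp

lemma dist3_le_len:
  assumes "a \<le> s" "s \<le> t" "t \<le> b"
  shows "ennreal (dist (\<gamma> a) (\<gamma> s) + dist (\<gamma> s) (\<gamma> t) + dist (\<gamma> t) (\<gamma> b)) \<le> len a b \<gamma>"
  using polygon_le_len[of "[a, s, t, b]" a b \<gamma>] assms
  by (simp add: numeral_2_eq_2 numeral_3_eq_3 lessThan_Suc add_ac)

lemma arclength_parametrized_dist_le:
  assumes "arclength_parametrized (K, \<gamma>)" "0 \<le> s" "s \<le> t" "t \<le> K"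
  shows "dist (\<gamma> s) (\<gamma> t) \<le> t - s"
proof -
  have "len s t \<gamma> = ennreal (t - s)"
    using assms by (simp add: arclength_parametrized_def)
  with dist_le_len[OF assms(3), of \<gamma>] assms(3) show ?thesis
    by (simp add: ennreal_le_iff)
qed

lemma short_segment_exists:
  fixes x y :: "'a::metric_space"
  assumes "length_space TYPE('a)" "0 < h"
  obtains K \<sigma> where "short_segment h x y (K, \<sigma>)"
proof -
  have "ennreal (dist x y) < ennreal (dist x y + h)"
    using assms(2) by (simp add: ennreal_less_iff)
  then have "(INF (L, \<gamma>) \<in> {p. path_from_to p x y}. len 0 L \<gamma>) < ennreal (dist x y + h)"
    using assms(1) by (simp add: length_space_def)
  then obtain K \<sigma> where "path_from_to (K, \<sigma>) x y" "len 0 K \<sigma> < ennreal (dist x y + h)"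
    by (auto simp: INF_less_iff)
  then have "short_segment h x y (K, \<sigma>)"
    using assms(2) by (simp add: short_segment_def less_imp_le)
  then show ?thesis by (rule that)
qed

lemma short_segment_mono:
  assumes "short_segment h x y p" "h \<le> k"
  shows "short_segment k x y p"
proof (cases p)
  case (Pair L \<gamma>)
  have "ennreal (dist x y + h) \<le> ennreal (dist x y + k)"
    using assms(2) by (intro ennreal_leI) simp
  with assms show ?thesis
    unfolding Pair short_segment_def prod.case by (meson order_trans)
qed

text \<open>The distance to \<open>x\<close> is continuous along the segment and runs from 0 to
  \<open>dist x y\<close>. Points are picked by this distance because \<open>\<sigma>\<close> need
  not be parametrized by arclength.\<close>

lemma short_segment_point_at_dist:
  assumes "short_segment h x y (K, \<sigma>)" "0 \<le> p" "p \<le> dist x y"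
  obtains s where "0 \<le> s" "s \<le> K" "dist x (\<sigma> s) = p"
proof -
  have *: "0 \<le> K" "continuous_on {0..K} \<sigma>" "\<sigma> 0 = x" "\<sigma> K = y"
    using assms(1) by (auto simp: short_segment_def path_from_to_def)
  then have "continuous_on {0..K} (\<lambda>s. dist x (\<sigma> s))"
    by (intro continuous_intros)
  then have "\<exists>s\<ge>0. s \<le> K \<and> dist x (\<sigma> s) = p"
    using * assms(2,3) by (intro IVT') auto
  then show ?thesis using that by blast
qed

text \<open>Distance from \<open>x\<close> almost plays the role of arclength: for
  \<open>s \<le> t\<close> the polygon through \<open>x\<close>, \<open>\<sigma> s\<close>,
  \<open>\<sigma> t\<close>, \<open>y\<close> has length at most \<open>dist x y + h\<close>, and
  the triangle inequality through \<open>\<sigma> t\<close> bounds \<open>dist x y\<close>.\<close>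

lemma short_segment_dist_le:
  assumes "short_segment h x y (K, \<sigma>)" "0 \<le> s" "s \<le> K" "0 \<le> t" "t \<le> K"
  shows "dist (\<sigma> s) (\<sigma> t) \<le> \<bar>dist x (\<sigma> s) - dist x (\<sigma> t)\<bar> + h"
proof -
  have ends: "\<sigma> 0 = x" "\<sigma> K = y" and "0 \<le> h" "len 0 K \<sigma> \<le> ennreal (dist x y + h)"
    using assms(1) by (auto simp: short_segment_def path_from_to_def)
  have *: "dist (\<sigma> s) (\<sigma> t) \<le> dist x (\<sigma> t) - dist x (\<sigma> s) + h"
    if "0 \<le> s" "s \<le> t" "t \<le> K" for s t
  proof -
    have "ennreal (dist x (\<sigma> s) + dist (\<sigma> s) (\<sigma> t) + dist (\<sigma> t) y) \<le> ennreal (dist x y + h)"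
      using dist3_le_len[OF that, of \<sigma>] ends \<open>len 0 K \<sigma> \<le> _\<close> by (metis order_trans)
    then have "dist x (\<sigma> s) + dist (\<sigma> s) (\<sigma> t) + dist (\<sigma> t) y \<le> dist x y + h"
      using \<open>0 \<le> h\<close> by (simp add: ennreal_le_iff del: ennreal_plus)
    with dist_triangle[of x y "\<sigma> t"] show ?thesis by linarith
  qed
  show ?thesis
  proof (cases "s \<le> t")
    case True
    then show ?thesis using *[of s t] assms by linarith
  next
    case False
    then show ?thesis using *[of t s] assms by (simp add: dist_commute[of "\<sigma> s"])
  qed
qed

section \<open>Euclidean geometry of the comparison triangle\<close>

lemma dist_vector_2:
  "dist (vector [a, b] :: real^2) (vector [c, d]) = sqrt ((a - c)\<^sup>2 + (b - d)\<^sup>2)"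
  by (simp add: dist_vec_def L2_set_def sum_2 dist_real_def)

text \<open>This is the triangle inequality for the vectors \<open>(\<alpha>, \<beta>)\<close> and
  \<open>(L - \<alpha>, \<beta>)\<close>, which have lengths \<open>a\<close> and \<open>b\<close>
  and sum \<open>(L, 2 * \<beta>)\<close>. It is derived from the Cauchy-Schwarz inequality.\<close>

lemma ellipse_altitude:
  fixes \<alpha> \<beta> L a b :: real
  assumes "a \<ge> 0" "b \<ge> 0" "a\<^sup>2 = \<alpha>\<^sup>2 + \<beta>\<^sup>2" "b\<^sup>2 = (L - \<alpha>)\<^sup>2 + \<beta>\<^sup>2"
  shows "L\<^sup>2 + 4 * \<beta>\<^sup>2 \<le> (a + b)\<^sup>2"
proof -
  have "(\<alpha> * (L - \<alpha>) + \<beta> * \<beta>)\<^sup>2 \<le> (a * b)\<^sup>2"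
  proof -
    \<comment> \<open>Lagrange's identity: the defect in Cauchy-Schwarz is the squared determinant
      of the two vectors.\<close>
    have "(a * b)\<^sup>2 - (\<alpha> * (L - \<alpha>) + \<beta> * \<beta>)\<^sup>2 = (\<alpha> * \<beta> - \<beta> * (L - \<alpha>))\<^sup>2"
      unfolding power_mult_distrib assms by (simp add: power2_eq_square algebra_simps)
    then show ?thesis by (metis diff_ge_0_iff_ge zero_le_power2)
  qed
  then have "\<alpha> * (L - \<alpha>) + \<beta> * \<beta> \<le> a * b"
    using assms(1,2) by (meson power2_le_imp_le mult_nonneg_nonneg)
  moreover have "(a + b)\<^sup>2 = a\<^sup>2 + b\<^sup>2 + 2 * (a * b)"
    by (simp add: power2_sum)
  ultimately show ?thesis
    using assms(3,4) by (simp add: power2_eq_square algebra_simps)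
qed

text \<open>The base lies on the first axis from the origin to \<open>(L, 0)\<close>, and
  \<open>u'\<close> is the point of the base nearest to the apex: the foot of the altitude or, if
  that falls outside the base, an end.\<close>

lemma comparison_triangle_base_point:
  fixes a b L h t :: real
  assumes "0 \<le> a" "0 \<le> b" "0 \<le> L" "L \<le> a + b" "a \<le> L + b" "b \<le> L + a"
    and "a \<le> t" "b \<le> L + h - t"
  obtains x' y' z' u' :: "real^2" where
    "dist x' y' = a" "dist y' z' = L" "dist z' x' = b" "u' \<in> closed_segment y' z'"
    "t - h \<le> dist y' u'" "dist y' u' \<le> t" "dist x' u' \<le> sqrt (2 * L * h + h\<^sup>2) / 2"
proof -
  \<comment> \<open>The first coordinate of the apex, by the law of cosines. For
    \<open>L = 0\<close> the value 0 is consistent, since then \<open>a = b\<close>.\<close>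
  define \<alpha> where "\<alpha> = (if L = 0 then 0 else (a\<^sup>2 - b\<^sup>2 + L\<^sup>2) / (2 * L))"
  define \<beta> where "\<beta> = sqrt (a\<^sup>2 - \<alpha>\<^sup>2)"
  have \<alpha>: "2 * L * \<alpha> = a\<^sup>2 - b\<^sup>2 + L\<^sup>2"
    using assms by (auto simp: \<alpha>_def)
  \<comment> \<open>This makes the radicand in \<open>\<beta>\<close> nonnegative; it rests on the
    triangle inequalities between \<open>a\<close>, \<open>b\<close> and \<open>L\<close>.\<close>
  have "\<bar>\<alpha>\<bar> \<le> a"
  proof (cases "L = 0")
    case True
    then show ?thesis using assms by (simp add: \<alpha>_def)
  next
    case False
    with assms have "L > 0" by simp
    have "b\<^sup>2 \<le> (L + a)\<^sup>2" "(L - a)\<^sup>2 \<le> b\<^sup>2"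
      using assms by (auto simp: abs_le_square_iff[symmetric])
    then have "2 * L * \<alpha> \<le> 2 * L * a" "2 * L * (- a) \<le> 2 * L * \<alpha>"
      unfolding \<alpha> by (auto simp: power2_sum power2_diff)
    moreover have "0 < 2 * L" using \<open>L > 0\<close> by simp
    ultimately have "\<alpha> \<le> a" "- a \<le> \<alpha>"
      using mult_le_cancel_left_pos[of "2 * L" \<alpha> a] mult_le_cancel_left_pos[of "2 * L" "- a" \<alpha>]
      by simp_all
    then show ?thesis by linarith
  qed
  then have "\<alpha>\<^sup>2 \<le> a\<^sup>2" by (metis abs_le_square_iff abs_of_nonneg assms(1))
  then have \<beta>: "\<beta>\<^sup>2 = a\<^sup>2 - \<alpha>\<^sup>2" by (simp add: \<beta>_def)
  have a2: "a\<^sup>2 = \<alpha>\<^sup>2 + \<beta>\<^sup>2" and b2: "b\<^sup>2 = (L - \<alpha>)\<^sup>2 + \<beta>\<^sup>2"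
    using \<beta> \<alpha> unfolding power2_diff by linarith+
  have sq: "(a + b)\<^sup>2 \<le> (L + h)\<^sup>2"
    using assms by (intro power_mono) auto
  define x' y' z' :: "real^2"
    where "x' = vector [\<alpha>, \<beta>]" and "y' = vector [0, 0]" and "z' = vector [L, 0]"
  have triangle: "dist x' y' = a" "dist y' z' = L" "dist z' x' = b"
    unfolding x'_def y'_def z'_def dist_vector_2
    by (simp_all add: assms(1-3) a2[symmetric] b2[symmetric])
  have "\<exists>p. 0 \<le> p \<and> p \<le> L \<and> t - h \<le> p \<and> p \<le> t \<and>
      4 * ((\<alpha> - p)\<^sup>2 + \<beta>\<^sup>2) \<le> 2 * L * h + h\<^sup>2"
  proof -
    \<comment> \<open>The witness \<open>p\<close> is \<open>\<alpha>\<close>, \<open>0\<close> or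
      \<open>L\<close> respectively. In the last two cases the angle at the nearest end is obtuse.
      In all cases \<open>p \<le> a\<close> or \<open>p = 0\<close> gives \<open>p \<le> t\<close>,
      and \<open>L - p \<le> b\<close> or \<open>p = L\<close> gives
      \<open>t - h \<le> p\<close>.\<close>
    consider "0 \<le> \<alpha>" "\<alpha> \<le> L" | "\<alpha> < 0" | "L < \<alpha>" by linarith
    then show ?thesis
    proof cases
      case 1
      have "\<bar>L - \<alpha>\<bar> \<le> \<bar>b\<bar>"
        unfolding abs_le_square_iff b2 by simp
      moreover have "4 * \<beta>\<^sup>2 \<le> 2 * L * h + h\<^sup>2"
        using ellipse_altitude[OF assms(1,2) a2 b2] sq by (simp add: power2_sum)
      ultimately show ?thesis
        using 1 assms \<open>\<bar>\<alpha>\<bar> \<le> a\<close> by (intro exI[of _ \<alpha>]) auto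
    next
      case 2
      then have "2 * L * \<alpha> \<le> 0" using assms by (simp add: mult_nonneg_nonpos)
      then have le: "a\<^sup>2 + L\<^sup>2 \<le> b\<^sup>2" using \<alpha> by linarith
      then have "L\<^sup>2 \<le> b\<^sup>2" "a\<^sup>2 \<le> b\<^sup>2"
        using zero_le_power2[of a] zero_le_power2[of b] zero_le_power2[of L] by linarith+
      then have "L \<le> b" "a \<le> b" using assms by (auto intro: power2_le_imp_le)
      \<comment> \<open>Together with \<open>a\<^sup>2 + L\<^sup>2 \<le> b\<^sup>2\<close> this
        yields \<open>L\<^sup>2 + 4 * a\<^sup>2 \<le> (a + b)\<^sup>2\<close>, the altitude bound
        with \<open>a\<close> in place of \<open>\<beta>\<close>.\<close>
      then have "a * a \<le> a * b" using assms by (simp add: mult_left_mono)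
      then have "4 * a\<^sup>2 \<le> 2 * L * h + h\<^sup>2"
        using le sq by (simp add: power2_eq_square algebra_simps)
      then show ?thesis
        using assms \<open>L \<le> b\<close> a2 by (intro exI[of _ 0]) auto
    next
      case 3
      then have "L * L \<le> L * \<alpha>" using assms by (simp add: mult_left_mono)
      then have le: "b\<^sup>2 + L\<^sup>2 \<le> a\<^sup>2" using \<alpha> by (simp add: power2_eq_square)
      then have "L\<^sup>2 \<le> a\<^sup>2" "b\<^sup>2 \<le> a\<^sup>2"
        using zero_le_power2[of a] zero_le_power2[of b] zero_le_power2[of L] by linarith+
      then have "L \<le> a" "b \<le> a" using assms by (auto intro: power2_le_imp_le)
      then have "b * b \<le> a * b" using assms by (simp add: mult_right_mono)
      then have "4 * b\<^sup>2 \<le> 2 * L * h + h\<^sup>2"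
        using le sq by (simp add: power2_eq_square algebra_simps)
      then show ?thesis
        using assms \<open>L \<le> a\<close> b2 by (intro exI[of _ L]) (auto simp: power2_commute)
    qed
  qed
  then obtain p where p: "0 \<le> p" "p \<le> L" "t - h \<le> p" "p \<le> t"
    and le: "4 * ((\<alpha> - p)\<^sup>2 + \<beta>\<^sup>2) \<le> 2 * L * h + h\<^sup>2" by blast
  define u' :: "real^2" where "u' = vector [p, 0]"
  have u': "dist y' u' = p" "dist u' z' = L - p"
    using p by (simp_all add: u'_def y'_def z'_def dist_vector_2)
  have "u' \<in> closed_segment y' z'"
    unfolding between_mem_segment[symmetric] between using u' triangle by simp
  moreover have "dist x' u' \<le> sqrt (2 * L * h + h\<^sup>2) / 2"
  proof -
    have "dist x' u' = sqrt (4 * ((\<alpha> - p)\<^sup>2 + \<beta>\<^sup>2)) / 2"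
      unfolding x'_def u'_def dist_vector_2 real_sqrt_mult by simp
    also have "\<dots> \<le> sqrt (2 * L * h + h\<^sup>2) / 2"
      using le by (intro divide_right_mono real_sqrt_le_mono) auto
    finally show ?thesis .
  qed
  ultimately show ?thesis
    using that[OF triangle] u'(1) p by simp
qed

section \<open>Comparison with an almost geodesic base\<close>

text \<open>The weak rCAT condition for the triangle with apex \<open>u\<close> and base
  \<open>\<sigma>\<close>. Both \<open>\<delta>\<close> and \<open>p\<close> are fixed before
  \<open>\<sigma>\<close>, so that a single \<open>\<sigma>\<close> can later serve two
  apexes.\<close>

lemma weak_rCAT0_dist_short_segment:
  fixes u x y :: "'a::metric_space"
  assumes "weak_rCAT0 C TYPE('a)" "dist x u \<le> t" "dist u y \<le> dist x y + h - t"
  obtains \<delta> p where "0 < \<delta>" "t - h \<le> p" "p \<le> t"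
    "\<And>K \<sigma>. short_segment \<delta> x y (K, \<sigma>) \<Longrightarrow> \<exists>s. 0 \<le> s \<and> s \<le> K \<and> dist x (\<sigma> s) = p \<and>
       dist u (\<sigma> s) \<le> sqrt (2 * dist x y * h + h\<^sup>2) / 2 + C"
proof -
  from assms(1) obtain H :: "'a \<Rightarrow> 'a \<Rightarrow> 'a \<Rightarrow> real" where ls: "length_space TYPE('a)"
    and H: "\<And>x y z. 0 < H x y z"
    and rCAT: "\<And>x y z pxy L \<gamma> pzx x' y' z' t u'.
          short_triangle (H x y z) x y z pxy (L, \<gamma>) pzx \<Longrightarrow>
          comparison_triangle x y z x' y' z' \<Longrightarrow> t \<in> {0..L} \<Longrightarrow>
          comparison_point (L, \<gamma>) t y' z' u' \<Longrightarrow> dist x (\<gamma> t) \<le> dist x' u' + C"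
    unfolding weak_rCAT0_def by blast
  obtain x' y' z' u' :: "real^2" where tri:
    "dist x' y' = dist u x" "dist y' z' = dist x y" "dist z' x' = dist y u"
    and u': "u' \<in> closed_segment y' z'" "t - h \<le> dist y' u'" "dist y' u' \<le> t"
    "dist x' u' \<le> sqrt (2 * dist x y * h + h\<^sup>2) / 2"
    by (rule comparison_triangle_base_point[of "dist u x" "dist y u" "dist x y" t h])
      (use assms(2,3) in \<open>auto simp: dist_commute dist_triangle dist_triangle2 dist_triangle3
        add.commute\<close>)
  have sum: "dist x y = dist y' u' + dist u' z'"
    using u'(1) tri unfolding between_mem_segment[symmetric] between by simp
  show ?thesis
  proof (rule that[OF H[of u x y] u'(2,3)])
    fix K \<sigma>
    assume \<sigma>: "short_segment (H u x y) x y (K, \<sigma>)"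
    have ends: "\<sigma> 0 = x" "\<sigma> K = y"
      using \<sigma> by (auto simp: short_segment_def path_from_to_def)
    \<comment> \<open>The point of \<open>\<sigma>\<close> as far from \<open>x\<close> as
      \<open>u'\<close> is from \<open>y'\<close>. Since \<open>dist y' u'\<close> and
      \<open>dist u' z'\<close> add up to \<open>dist x y\<close>, its distance to \<open>y\<close>
      is at least \<open>dist u' z'\<close>, which makes \<open>u'\<close> a comparison point for
      it.\<close>
    obtain s where s: "0 \<le> s" "s \<le> K" "dist x (\<sigma> s) = dist y' u'"
      using short_segment_point_at_dist[OF \<sigma>, of "dist y' u'"] sum by auto
    obtain K1 \<sigma>1 K2 \<sigma>2 where "short_segment (H u x y) u x (K1, \<sigma>1)"
      "short_segment (H u x y) y u (K2, \<sigma>2)"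
      using short_segment_exists[OF ls H] by metis
    with \<sigma> have "short_triangle (H u x y) u x y (K1, \<sigma>1) (K, \<sigma>) (K2, \<sigma>2)"
      by (simp add: short_triangle_def)
    moreover have "comparison_triangle u x y x' y' z'"
      using tri by (simp add: comparison_triangle_def)
    moreover have "comparison_point (K, \<sigma>) s y' z' u'"
    proof -
      have "dist u' z' \<le> dist (\<sigma> s) y"
        using sum s(3) dist_triangle[of x y "\<sigma> s"] by linarith
      then have "ennreal (dist u' z') \<le> len s K \<sigma>"
        using dist_le_len[OF s(2), of \<sigma>] ends by (metis ennreal_leI order_trans)
      then show ?thesis
        using dist_le_len[OF s(1), of \<sigma>] ends s(3) u'(1) by (simp add: comparison_point_def)
    qed
    ultimately have "dist u (\<sigma> s) \<le> dist x' u' + C"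
      using rCAT s by simp
    with u'(4) s show "\<exists>s. 0 \<le> s \<and> s \<le> K \<and> dist x (\<sigma> s) = dist y' u' \<and>
       dist u (\<sigma> s) \<le> sqrt (2 * dist x y * h + h\<^sup>2) / 2 + C"
      by (intro exI[of _ s]) auto
  qed
qed

theorem theorem4p2:
  fixes x y :: "'a::metric_space"
    and C L h\<^sub>1 h\<^sub>2 :: real
    and \<gamma>\<^sub>1 \<gamma>\<^sub>2 :: "real \<Rightarrow> 'a"
  assumes "C > 0"
    and "weak_rCAT0 C TYPE('a)"
    and "L = dist x y"
    and "h\<^sub>1 > 0" and "h\<^sub>2 > 0"
    and "short_segment h\<^sub>1 x y (L + h\<^sub>1, \<gamma>\<^sub>1)" and "arclength_parametrized (L + h\<^sub>1, \<gamma>\<^sub>1)"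
    and "short_segment h\<^sub>2 x y (L + h\<^sub>2, \<gamma>\<^sub>2)" and "arclength_parametrized (L + h\<^sub>2, \<gamma>\<^sub>2)"
    and "h\<^sub>1 \<le> h\<^sub>2"
  shows "(\<forall>t\<in>{0..L + h\<^sub>1}. dist (\<gamma>\<^sub>1 t) (\<gamma>\<^sub>2 t)
            \<le> 2 * C + h\<^sub>2 + sqrt (2 * L * h\<^sub>1 + h\<^sub>1\<^sup>2) / 2 + sqrt (2 * L * h\<^sub>2 + h\<^sub>2\<^sup>2) / 2) \<and>
         (h\<^sub>2 \<le> 1 / max 1 L \<longrightarrow>
            (\<forall>t\<in>{0..L + h\<^sub>1}. dist (\<gamma>\<^sub>1 t) (\<gamma>\<^sub>2 t) \<le> 2 * C + 1 + sqrt 3))"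
proof -
  have bound: "dist (\<gamma>\<^sub>1 t) (\<gamma>\<^sub>2 t)
      \<le> 2 * C + h\<^sub>2 + sqrt (2 * L * h\<^sub>1 + h\<^sub>1\<^sup>2) / 2 + sqrt (2 * L * h\<^sub>2 + h\<^sub>2\<^sup>2) / 2"
    if t: "t \<in> {0..L + h\<^sub>1}" for t
  proof (rule field_le_epsilon)
    fix e :: real
    assume "0 < e"
    \<comment> \<open>Proved for general \<open>h\<close> to cover both curves;
      \<open>h\<^sub>1 \<le> h\<close> keeps \<open>t\<close> in the parameter interval of
      \<open>\<gamma>\<close>.\<close>
    have near: "dist x (\<gamma> t) \<le> t" "dist (\<gamma> t) y \<le> dist x y + h - t"
      if "short_segment h x y (L + h, \<gamma>)" "arclength_parametrized (L + h, \<gamma>)" "h\<^sub>1 \<le> h" for h \<gamma>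
    proof -
      have "\<gamma> 0 = x" "\<gamma> (L + h) = y"
        using that(1) by (auto simp: short_segment_def path_from_to_def)
      then show "dist x (\<gamma> t) \<le> t" "dist (\<gamma> t) y \<le> dist x y + h - t"
        using arclength_parametrized_dist_le[OF that(2), of 0 t]
          arclength_parametrized_dist_le[OF that(2), of t "L + h"] t that(3) assms(3) by auto
    qed
    obtain \<delta>1 p1 where \<delta>1: "0 < \<delta>1" and p1: "t - h\<^sub>1 \<le> p1" "p1 \<le> t"
      and close1: "\<And>K \<sigma>. short_segment \<delta>1 x y (K, \<sigma>) \<Longrightarrow> \<exists>s. 0 \<le> s \<and> s \<le> K \<and> dist x (\<sigma> s) = p1 \<and>
        dist (\<gamma>\<^sub>1 t) (\<sigma> s) \<le> sqrt (2 * dist x y * h\<^sub>1 + h\<^sub>1\<^sup>2) / 2 + C"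
      using weak_rCAT0_dist_short_segment[OF assms(2) near[OF assms(6,7) order_refl]] by metis
    obtain \<delta>2 p2 where \<delta>2: "0 < \<delta>2" and p2: "t - h\<^sub>2 \<le> p2" "p2 \<le> t"
      and close2: "\<And>K \<sigma>. short_segment \<delta>2 x y (K, \<sigma>) \<Longrightarrow> \<exists>s. 0 \<le> s \<and> s \<le> K \<and> dist x (\<sigma> s) = p2 \<and>
        dist (\<gamma>\<^sub>2 t) (\<sigma> s) \<le> sqrt (2 * dist x y * h\<^sub>2 + h\<^sub>2\<^sup>2) / 2 + C"
      using weak_rCAT0_dist_short_segment[OF assms(2) near[OF assms(8,9,10)]] by metis
    \<comment> \<open>Short enough for both triangles, with the excess length of
      \<open>\<sigma>\<close> absorbed by \<open>e\<close>.\<close>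
    define d where "d = min e (min \<delta>1 \<delta>2)"
    have "0 < d" "d \<le> e" "d \<le> \<delta>1" "d \<le> \<delta>2"
      using \<open>0 < e\<close> \<delta>1 \<delta>2 by (auto simp: d_def)
    have "length_space TYPE('a)" using assms(2) by (simp add: weak_rCAT0_def)
    then obtain K \<sigma> where \<sigma>: "short_segment d x y (K, \<sigma>)"
      using \<open>0 < d\<close> short_segment_exists by blast
    obtain s1 where s1: "0 \<le> s1" "s1 \<le> K" "dist x (\<sigma> s1) = p1"
      "dist (\<gamma>\<^sub>1 t) (\<sigma> s1) \<le> sqrt (2 * L * h\<^sub>1 + h\<^sub>1\<^sup>2) / 2 + C"
      using close1[OF short_segment_mono[OF \<sigma> \<open>d \<le> \<delta>1\<close>]] assms(3) by auto
    obtain s2 where s2: "0 \<le> s2" "s2 \<le> K" "dist x (\<sigma> s2) = p2"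
      "dist (\<gamma>\<^sub>2 t) (\<sigma> s2) \<le> sqrt (2 * L * h\<^sub>2 + h\<^sub>2\<^sup>2) / 2 + C"
      using close2[OF short_segment_mono[OF \<sigma> \<open>d \<le> \<delta>2\<close>]] assms(3) by auto
    \<comment> \<open>As \<open>h\<^sub>1 \<le> h\<^sub>2\<close>, both \<open>p1\<close> and
      \<open>p2\<close> lie in \<open>[t - h\<^sub>2, t]\<close>.\<close>
    have "dist (\<sigma> s1) (\<sigma> s2) \<le> h\<^sub>2 + e"
      using short_segment_dist_le[OF \<sigma> s1(1,2) s2(1,2)] s1(3) s2(3) p1 p2 assms(10) \<open>d \<le> e\<close>
      by linarith
    moreover have "dist (\<gamma>\<^sub>1 t) (\<gamma>\<^sub>2 t)
        \<le> dist (\<gamma>\<^sub>1 t) (\<sigma> s1) + dist (\<sigma> s1) (\<sigma> s2) + dist (\<gamma>\<^sub>2 t) (\<sigma> s2)"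
      using dist_triangle[of "\<gamma>\<^sub>1 t" "\<gamma>\<^sub>2 t" "\<sigma> s1"] dist_triangle2[of "\<sigma> s1" "\<gamma>\<^sub>2 t" "\<sigma> s2"]
      by linarith
    ultimately show "dist (\<gamma>\<^sub>1 t) (\<gamma>\<^sub>2 t)
      \<le> 2 * C + h\<^sub>2 + sqrt (2 * L * h\<^sub>1 + h\<^sub>1\<^sup>2) / 2 + sqrt (2 * L * h\<^sub>2 + h\<^sub>2\<^sup>2) / 2 + e"
      using s1(4) s2(4) by linarith
  qed
  moreover have "dist (\<gamma>\<^sub>1 t) (\<gamma>\<^sub>2 t) \<le> 2 * C + 1 + sqrt 3"
    if h2: "h\<^sub>2 \<le> 1 / max 1 L" and t: "t \<in> {0..L + h\<^sub>1}" for t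
  proof -
    have "h\<^sub>2 * max 1 L \<le> 1"
      using h2 by (simp add: pos_le_divide_eq)
    moreover have "h\<^sub>2 * 1 \<le> h\<^sub>2 * max 1 L" "h\<^sub>2 * L \<le> h\<^sub>2 * max 1 L"
      using assms(5) by (auto intro: mult_left_mono)
    ultimately have h2': "h\<^sub>2 \<le> 1" "L * h\<^sub>2 \<le> 1" by (auto simp: mult.commute)
    \<comment> \<open>The radicand is at most \<open>2 * 1 + 1\<close>. The two halved roots then
      add up to at most \<open>sqrt 3\<close>.\<close>
    have root: "sqrt (2 * L * h + h\<^sup>2) \<le> sqrt 3" if "0 < h" "h \<le> h\<^sub>2" for h
    proof -
      have "L * h \<le> L * h\<^sub>2" using that assms(3) by (simp add: mult_left_mono)
      moreover have "h\<^sup>2 \<le> 1" using that h2'(1) by (simp add: power_le_one)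
      ultimately show ?thesis using h2'(2) by simp
    qed
    show ?thesis
      using bound[OF t] root[OF assms(4,10)] root[OF assms(5) order_refl] h2'(1) by linarith
  qed
  ultimately show ?thesis by blast
qed

end
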